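(* The class $\mathrm{Av}(123)$ is LR-amalgamable.
   Context: A permutation of length $n\ge 1$ is a sequence of all the $n$ distinct numbers of $[n]=\{1,\dots,n\}$. An embedding of a permutation $\sigma$ of length $k$ into a permutation $\pi$ of length $n$ is a strictly increasing function $f:[k]\to[n]$ such that $\pi_{f(1)},\dots,\pi_{f(k)}$ is order-isomorphic to $\sigma$ (has the same relative order). $\pi$ avoids $\sigma$ if no such embedding exists, and $\mathrm{Av}(\sigma)$ is the set of all permutations avoiding $\sigma$. A permutation class is a set of permutations closed under taking contained permutations. An element $\pi_i$ is a left-to-right minimum (LR-minimum) of $\pi$ if it is smaller than all elements preceding it. A permutation class $C$ is LR-amalgamable if for any $\tau_1,\tau_2\in C$ and any mappings $f_1,f_2$, where $f_i$ is an embedding of the singleton permutation into $\tau_i$ whose image is not an LR-minimum of $\tau_i$, there is $\sigma\in C$ and mappings $g_1,g_2$ such that $g_i$ is an embedding of $\tau_i$ into $\sigma$, $g_1\circ f_1=g_2\circ f_2$, and moreover each $g_i$ preserves the property of being an LR-minimum (it maps LR-minima of $\tau_i$ to LR-minima of $\sigma$). *)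

theory Defs
  imports Main
begin

text \<open>
  A permutation of length \<open>n \<ge> 1\<close> is the list of its entries, so its values are \<open>1, \<dots>, n\<close>,
  whereas its positions are the list indices \<open>0, \<dots>, n - 1\<close> (position \<open>i\<close> here is position
  \<open>i + 1\<close> in the usual one-line notation).
\<close>

definition is_perm :: "nat list \<Rightarrow> bool" where
  "is_perm \<pi> \<longleftrightarrow> \<pi> \<noteq> [] \<and> distinct \<pi> \<and> set \<pi> = {1..length \<pi>}"

text \<open>
  Only the values of \<open>f\<close> on the positions of \<open>\<sigma>\<close> are relevant.
\<close>

definition embedding :: "(nat \<Rightarrow> nat) \<Rightarrow> nat list \<Rightarrow> nat list \<Rightarrow> bool" where
  "embedding f \<sigma> \<pi> \<longleftrightarrow>
     f ` {..<length \<sigma>} \<subseteq> {..<length \<pi>} \<and>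
     strict_mono_on {..<length \<sigma>} f \<and>
     (\<forall>i<length \<sigma>. \<forall>j<length \<sigma>. \<sigma> ! i < \<sigma> ! j \<longleftrightarrow> \<pi> ! f i < \<pi> ! f j)"

definition contains :: "nat list \<Rightarrow> nat list \<Rightarrow> bool" where
  "contains \<pi> \<sigma> \<longleftrightarrow> (\<exists>f. embedding f \<sigma> \<pi>)"

definition Av :: "nat list \<Rightarrow> nat list set" where
  "Av \<sigma> = {\<pi>. is_perm \<pi> \<and> \<not> contains \<pi> \<sigma>}"

definition perm_class :: "nat list set \<Rightarrow> bool" where
  "perm_class C \<longleftrightarrow>
     (\<forall>\<pi>\<in>C. is_perm \<pi>) \<and>
     (\<forall>\<pi>\<in>C. \<forall>\<sigma>. is_perm \<sigma> \<and> contains \<pi> \<sigma> \<longrightarrow> \<sigma> \<in> C)"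

definition LR_min :: "nat list \<Rightarrow> nat \<Rightarrow> bool" where
  "LR_min \<pi> i \<longleftrightarrow> i < length \<pi> \<and> (\<forall>j<i. \<pi> ! i < \<pi> ! j)"

definition preserves_LR_min :: "(nat \<Rightarrow> nat) \<Rightarrow> nat list \<Rightarrow> nat list \<Rightarrow> bool" where
  "preserves_LR_min g \<tau> \<sigma> \<longleftrightarrow> (\<forall>i. LR_min \<tau> i \<longrightarrow> LR_min \<sigma> (g i))"

text \<open>
  The singleton permutation is \<open>[1]\<close>. Its only position is \<open>0\<close>, so the image of an embedding
  \<open>f\<close> of it is the position \<open>f 0\<close>, and equality of two maps on its positions is equality at \<open>0\<close>.
\<close>

definition LR_amalgamable :: "nat list set \<Rightarrow> bool" where
  "LR_amalgamable C \<longleftrightarrow> perm_class C \<and>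
     (\<forall>\<tau>\<^sub>1\<in>C. \<forall>\<tau>\<^sub>2\<in>C. \<forall>f\<^sub>1 f\<^sub>2.
        embedding f\<^sub>1 [1] \<tau>\<^sub>1 \<and> \<not> LR_min \<tau>\<^sub>1 (f\<^sub>1 0) \<and>
        embedding f\<^sub>2 [1] \<tau>\<^sub>2 \<and> \<not> LR_min \<tau>\<^sub>2 (f\<^sub>2 0) \<longrightarrow>
        (\<exists>\<sigma>\<in>C. \<exists>g\<^sub>1 g\<^sub>2.
           embedding g\<^sub>1 \<tau>\<^sub>1 \<sigma> \<and> embedding g\<^sub>2 \<tau>\<^sub>2 \<sigma> \<and>
           (g\<^sub>1 \<circ> f\<^sub>1) 0 = (g\<^sub>2 \<circ> f\<^sub>2) 0 \<and>
           preserves_LR_min g\<^sub>1 \<tau>\<^sub>1 \<sigma> \<and> preserves_LR_min g\<^sub>2 \<tau>\<^sub>2 \<sigma>))"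

end

theory Submission
  imports Defs Complex_Main
begin

text \<open>
  A 123-avoiding permutation is a union of two decreasing sequences, its LR-minima and the remaining
  entries, and it can be drawn on two parallel lines of slope \<open>-1\<close>: the LR-minima on the lower line
  \<open>y = - x - 1\<close> and the other entries on the upper line \<open>y = - x\<close> (\<open>drawing_exists\<close>).

  Conversely, every finite set of points on these two lines, no two of which share a coordinate,
  has the order type of a 123-avoiding permutation, since among three points two lie on the same
  decreasing line. Moreover a point of the lower line never has another point to its lower left, so
  it is an LR-minimum (\<open>two_lines_perm\<close>).

  Hence two such permutations are amalgamated by superimposing their drawings. Both marked entries
  lie on the upper line, so translating along the lines makes them coincide in the
  point \<open>(0, 0)\<close>. A small further shift of all unmarked entries of the second drawing
  prevents any other coincidence of coordinates (\<open>drawing_generic\<close>).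
\<close>

section \<open>The class of 123-avoiding permutations\<close>

lemma embedding_comp:
  assumes f: "embedding f \<rho> \<sigma>" and g: "embedding g \<sigma> \<pi>"
  shows "embedding (g \<circ> f) \<rho> \<pi>"
proof -
  have "f i < length \<sigma>" if "i < length \<rho>" for i
    using f that by (auto simp: embedding_def)
  then show ?thesis
    using f g by (auto simp: embedding_def strict_mono_on_def image_subset_iff)
qed

lemma perm_class_Av: "perm_class (Av \<sigma>)"
  unfolding perm_class_def Av_def contains_def by (auto intro: embedding_comp)

lemma contains_123_iff:
  "contains \<pi> [1, 2, 3] \<longleftrightarrow>
     (\<exists>i j k. i < j \<and> j < k \<and> k < length \<pi> \<and> \<pi> ! i < \<pi> ! j \<and> \<pi> ! j < \<pi> ! k)"
proof
  assume "contains \<pi> [1, 2, 3]"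
  then obtain f where f: "embedding f [1, 2, 3] \<pi>" by (auto simp: contains_def)
  have mono: "f i < f j" if "i < j" "j < 3" for i j
    using f that by (auto simp: embedding_def strict_mono_on_def)
  have val: "\<pi> ! f i < \<pi> ! f j" if "[1, 2, 3 :: nat] ! i < [1, 2, 3] ! j" "i < 3" "j < 3" for i j
    using f that by (auto simp: embedding_def)
  have "f 2 < length \<pi>" using f by (simp add: embedding_def image_subset_iff)
  then show "\<exists>i j k. i < j \<and> j < k \<and> k < length \<pi> \<and> \<pi> ! i < \<pi> ! j \<and> \<pi> ! j < \<pi> ! k"
    using mono[of 0 1] mono[of 1 2] val[of 0 1] val[of 1 2]
    by (intro exI[of _ "f 0"] exI[of _ "f 1"] exI[of _ "f 2"]) auto
next
  assume "\<exists>i j k. i < j \<and> j < k \<and> k < length \<pi> \<and> \<pi> ! i < \<pi> ! j \<and> \<pi> ! j < \<pi> ! k"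
  then obtain i j k where
    ijk: "i < j" "j < k" "k < length \<pi>" "\<pi> ! i < \<pi> ! j" "\<pi> ! j < \<pi> ! k" by blast
  have "embedding (\<lambda>x. [i, j, k] ! x) [1, 2, 3] \<pi>"
    using ijk by (auto simp: embedding_def strict_mono_on_def less_Suc_eq numeral_3_eq_3)
  then show "contains \<pi> [1, 2, 3]" by (auto simp: contains_def)
qed

text \<open>
  If two such entries were increasing, an earlier entry below the first of them would complete a
  pattern 123.
\<close>

lemma non_LR_min_decreasing:
  assumes "distinct \<pi>" "\<not> contains \<pi> [1, 2, 3]"
    and "i < j" "j < length \<pi>" "\<not> LR_min \<pi> i" "\<not> LR_min \<pi> j"
  shows "\<pi> ! j < \<pi> ! i"
proof (rule ccontr)
  assume "\<not> \<pi> ! j < \<pi> ! i"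
  then have "\<pi> ! i < \<pi> ! j"
    using assms(1,3,4) by (metis less_imp_neq linorder_less_linear nth_eq_iff_index_eq order.strict_trans)
  moreover obtain h where "h < i" "\<pi> ! h < \<pi> ! i"
    using assms(1,3,4,5) unfolding LR_min_def
    by (metis less_imp_neq linorder_less_linear nth_eq_iff_index_eq order.strict_trans)
  ultimately show False using assms(2-4) unfolding contains_123_iff by blast
qed

section \<open>Drawings on two parallel lines\<close>

text \<open>
  The second coordinate of the point with first coordinate \<open>x\<close> on the lower line (if \<open>low\<close> holds) or
  on the upper line.
\<close>

definition height :: "bool \<Rightarrow> real \<Rightarrow> real" where
  "height low x = (if low then - x - 1 else - x)"

definition drawing :: "nat list \<Rightarrow> (nat \<Rightarrow> real) \<Rightarrow> bool" where
  "drawing \<tau> t \<longleftrightarrow>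
     strict_mono_on {..<length \<tau>} t \<and>
     (\<forall>i<length \<tau>. \<forall>j<length \<tau>.
        \<tau> ! i < \<tau> ! j \<longleftrightarrow> height (LR_min \<tau> i) (t i) < height (LR_min \<tau> j) (t j))"

text \<open>
  Two entries on the same line are automatically in the right relative position, so only the
  pairs of an LR-minimum \<open>i\<close> and another entry \<open>j\<close> matter. The entries are drawn from left to
  right. A new LR-minimum goes far to the right. A new entry \<open>k\<close> that is no LR-minimum must lie to
  the right of everything, less than one unit to the right of the first entry \<open>i\<^sub>0\<close> below it, and
  more than one unit to the right of the LR-minima before \<open>i\<^sub>0\<close>. The earlier upper points lie above
  \<open>k\<close>, hence above \<open>i\<^sub>0\<close>, and so to the left of \<open>t i\<^sub>0 + 1\<close>. All earlier points with
  \<open>t i \<ge> t i\<^sub>0 + 1\<close> are therefore LR-minima to the right of all the upper points, and they can be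
  squeezed to the left of \<open>t i\<^sub>0 + 1\<close> without changing any relation.
\<close>

lemma drawing_prefix_exists:
  assumes dist: "distinct \<tau>" and av: "\<not> contains \<tau> [1, 2, 3]"
  shows "k \<le> length \<tau> \<Longrightarrow> \<exists>t :: nat \<Rightarrow> real. strict_mono_on {..<k} t \<and>
    (\<forall>i<k. \<forall>j<k. LR_min \<tau> i \<longrightarrow> \<not> LR_min \<tau> j \<longrightarrow>
       (\<tau> ! i < \<tau> ! j \<longrightarrow> t j < t i + 1) \<and> (\<tau> ! j < \<tau> ! i \<longrightarrow> t i + 1 < t j))"
proof (induction k)
  case 0
  show ?case by (auto simp: strict_mono_on_def)
next
  case (Suc k)
  then obtain t :: "nat \<Rightarrow> real" where mono: "strict_mono_on {..<k} t"
    and below: "\<And>i j. \<lbrakk>i < k; j < k; LR_min \<tau> i; \<not> LR_min \<tau> j; \<tau> ! i < \<tau> ! j\<rbrakk> \<Longrightarrow> t j < t i + 1"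
    and above: "\<And>i j. \<lbrakk>i < k; j < k; LR_min \<tau> i; \<not> LR_min \<tau> j; \<tau> ! j < \<tau> ! i\<rbrakk> \<Longrightarrow> t i + 1 < t j"
    by auto
  have t_less: "t i < t j" if "i < j" "j < k" for i j
    using mono that by (auto simp: strict_mono_on_def)
  have k: "k < length \<tau>" using Suc.prems by simp
  show ?case
  proof (cases "LR_min \<tau> k")
    case True
    define b where "b = Max (insert 0 (t ` {..<k})) + 1"
    have b: "t i < b" if "i < k" for i
    proof -
      have "t i \<le> Max (insert 0 (t ` {..<k}))" using that by (intro Max_ge) auto
      then show ?thesis by (simp add: b_def)
    qed
    have new: "t j < b + 1 \<and> \<not> \<tau> ! j < \<tau> ! k" if "j < k" for j
      using b[OF that] True that by (auto simp: LR_min_def dest: less_asym)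
    show ?thesis
      using b t_less below above True new
      by (intro exI[of _ "t(k := b)"]) (auto simp: strict_mono_on_def less_Suc_eq)
  next
    case False
    obtain h where "h < k" "\<tau> ! h < \<tau> ! k"
      using False k dist unfolding LR_min_def
      by (metis less_imp_neq linorder_less_linear nth_eq_iff_index_eq order.strict_trans)
    define i0 where "i0 = (LEAST i. \<tau> ! i < \<tau> ! k)"
    have i0_less: "\<tau> ! i0 < \<tau> ! k"
      unfolding i0_def using \<open>\<tau> ! h < \<tau> ! k\<close> by (rule LeastI)
    have i0: "i0 < k"
      using Least_le[of "\<lambda>i. \<tau> ! i < \<tau> ! k" h] \<open>h < k\<close> \<open>\<tau> ! h < \<tau> ! k\<close>
      unfolding i0_def by simp
    have before_i0: "\<tau> ! k < \<tau> ! i" if "i < i0" for i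
    proof -
      have "\<not> \<tau> ! i < \<tau> ! k" using that not_less_Least unfolding i0_def by blast
      moreover have "\<tau> ! i \<noteq> \<tau> ! k"
        using that i0 k dist by (simp add: nth_eq_iff_index_eq)
      ultimately show ?thesis by simp
    qed
    have i0_min: "LR_min \<tau> i0"
      using before_i0 i0_less i0 k unfolding LR_min_def by (meson order.strict_trans)
    define b where "b = t i0 + 1"
    have upper: "t j < b" "\<tau> ! k < \<tau> ! j" if "j < k" "\<not> LR_min \<tau> j" for j
    proof -
      show "\<tau> ! k < \<tau> ! j"
        using non_LR_min_decreasing[OF dist av that(1) k that(2) False] .
      then show "t j < b"
        using below[OF i0 that(1) i0_min that(2)] i0_less by (simp add: b_def)
    qed
    \<comment> \<open>The entry \<open>k\<close> has to be drawn to the right of all points to the left of \<open>b\<close>, and below the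
       entries before \<open>i\<^sub>0\<close>; this is the lower bound \<open>u\<close>.\<close>
    define U where "U = t ` {i. i < k \<and> t i < b} \<union> (\<lambda>i. t i + 1) ` {..<i0}"
    define u where "u = Max U"
    have U: "finite U" "t i0 \<in> U" using i0 by (auto simp: U_def b_def)
    have u: "x \<le> u" if "x \<in> U" for x using U that by (simp add: u_def)
    have "u \<in> U" unfolding u_def using U by (intro Max_in) auto
    then have ub: "u < b" using t_less i0 by (auto simp: U_def b_def)
    define s where "s i = u + (b - u) * (real (i + 1) / real (k + 2))" for i
    have s_mono: "s i < s j" if "i < j" for i j
      using that ub by (simp add: s_def divide_strict_right_mono)
    have s_gt: "u < s i" for i using ub by (simp add: s_def)
    have s_lt: "s i < b" if "i \<le> k" for i
    proof -
      have "(b - u) * (real (i + 1) / real (k + 2)) < (b - u) * 1"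
        using that ub by (intro mult_strict_left_mono) auto
      then show ?thesis by (simp add: s_def)
    qed
    define t' where "t' i = (if i < k \<and> t i < b then t i else s i)" for i
    have t'_mono: "t' i < t' j" if "i < j" "j \<le> k" for i j
    proof (cases "j < k \<and> t j < b")
      case True
      then show ?thesis using t_less[OF that(1)] that by (auto simp: t'_def)
    next
      case F: False
      show ?thesis
      proof (cases "i < k \<and> t i < b")
        case True
        then have "t i \<le> u" by (intro u) (auto simp: U_def)
        then show ?thesis using True F s_gt[of j] by (auto simp: t'_def)
      qed (use F s_mono that in \<open>auto simp: t'_def\<close>)
    qed
    have t'_k: "t' k = s k" by (simp add: t'_def)
    have t'_i0: "t' i0 = t i0" using i0 by (simp add: t'_def b_def)
    have main: "(\<tau> ! i < \<tau> ! j \<longrightarrow> t' j < t' i + 1) \<and> (\<tau> ! j < \<tau> ! i \<longrightarrow> t' i + 1 < t' j)"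
      if ij: "i \<le> k" "j \<le> k" "LR_min \<tau> i" "\<not> LR_min \<tau> j" for i j
    proof -
      have i: "i < k" using ij False by (metis le_neq_implies_less)
      show ?thesis
      proof (cases "j = k")
        case True
        show ?thesis
        proof (cases "i < i0")
          case True
          then have "t i + 1 \<le> u" by (intro u) (auto simp: U_def)
          moreover have "t' i = t i" using t_less[OF True i0] i by (simp add: t'_def b_def)
          ultimately show ?thesis
            using s_gt[of k] before_i0[OF True] \<open>j = k\<close> t'_k by auto
        next
          case F: False
          then have "i = i0 \<or> t' i0 < t' i" using t'_mono[of i0 i] i by linarith
          then have "t' j < t' i + 1"
            using s_lt[of k] \<open>j = k\<close> t'_k t'_i0 by (auto simp: b_def)
          moreover have "i = i0 \<or> \<tau> ! i < \<tau> ! i0"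
            using F ij(3) linorder_neqE_nat unfolding LR_min_def by blast
          ultimately show ?thesis using i0_less \<open>j = k\<close> by auto
        qed
      next
        case False
        then have j: "j < k" using ij by simp
        then have tj: "t j < b" using upper ij by blast
        then have "t' j = t j" using j by (simp add: t'_def)
        show ?thesis
        proof (cases "t i < b")
          case True
          then have "t' i = t i" using i by (simp add: t'_def)
          then show ?thesis using \<open>t' j = t j\<close> below above i j ij by auto
        next
          case F: False
          have "t j \<le> u" using j tj by (intro u) (auto simp: U_def)
          then have "t' j < t' i + 1"
            using F \<open>t' j = t j\<close> s_gt[of i] by (auto simp: t'_def)
          moreover have "\<not> \<tau> ! j < \<tau> ! i" using above[OF i j ij(3,4)] tj F by auto
          ultimately show ?thesis by simp
        qed
      qed
    qed
    show ?thesis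
      using t'_mono main
      by (intro exI[of _ t']) (auto simp: strict_mono_on_def less_Suc_eq_le)
  qed
qed

lemma drawing_exists:
  assumes dist: "distinct \<tau>" and av: "\<not> contains \<tau> [1, 2, 3]"
  shows "\<exists>t. drawing \<tau> t"
proof -
  obtain t :: "nat \<Rightarrow> real" where mono: "strict_mono_on {..<length \<tau>} t"
    and mixed: "\<forall>i<length \<tau>. \<forall>j<length \<tau>. LR_min \<tau> i \<longrightarrow> \<not> LR_min \<tau> j \<longrightarrow>
       (\<tau> ! i < \<tau> ! j \<longrightarrow> t j < t i + 1) \<and> (\<tau> ! j < \<tau> ! i \<longrightarrow> t i + 1 < t j)"
    using drawing_prefix_exists[OF dist av order.refl] by blast
  define y where "y i = height (LR_min \<tau> i) (t i)" for i
  have cmp: "\<tau> ! i < \<tau> ! j \<and> y i < y j \<or> \<tau> ! j < \<tau> ! i \<and> y j < y i"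
    if ij: "i < j" "j < length \<tau>" for i j
  proof -
    have t: "t i < t j" using mono ij by (auto simp: strict_mono_on_def)
    have ne: "\<tau> ! i \<noteq> \<tau> ! j" using ij dist by (simp add: nth_eq_iff_index_eq)
    consider "LR_min \<tau> j" | "\<not> LR_min \<tau> j" "\<not> LR_min \<tau> i" | "\<not> LR_min \<tau> j" "LR_min \<tau> i" by blast
    then show ?thesis
    proof cases
      case 1
      then show ?thesis using t ij by (auto simp: y_def height_def LR_min_def)
    next
      case 2
      then show ?thesis
        using t non_LR_min_decreasing[OF dist av ij] by (auto simp: y_def height_def)
    next
      case 3
      then show ?thesis
        using mixed[rule_format, of i j] ij ne
        by (cases "\<tau> ! i < \<tau> ! j") (auto simp: y_def height_def)
    qed
  qed
  have "\<tau> ! i < \<tau> ! j \<longleftrightarrow> y i < y j" if "i < length \<tau>" "j < length \<tau>" for i j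
    using cmp[of i j] cmp[of j i] that by (cases i j rule: linorder_cases) auto
  then show ?thesis using mono by (auto simp: drawing_def y_def)
qed

lemma finite_gap:
  fixes v :: "'a \<Rightarrow> real"
  assumes "finite A"
  shows "\<exists>d>0. \<forall>i\<in>A. \<forall>j\<in>A. v i < v j \<longrightarrow> v i + d \<le> v j"
proof -
  define G where "G = insert 1 {z \<in> (\<lambda>(i, j). v j - v i) ` (A \<times> A). z > 0}"
  have G: "finite G" "G \<noteq> {}" "\<forall>z\<in>G. z > 0" using assms by (auto simp: G_def)
  have "v i + Min G \<le> v j" if "i \<in> A" "j \<in> A" "v i < v j" for i j
  proof -
    have "v j - v i \<in> G" using that by (force simp: G_def)
    then have "Min G \<le> v j - v i" using G by simp
    then show ?thesis by simp
  qed
  then show ?thesis using G by (intro exI[of _ "Min G"]) auto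
qed

text \<open>
  A translation moves \<open>p\<close> to parameter \<open>0\<close>. The conditions of a drawing are finitely many strict
  inequalities, so shifting the entries other
  than \<open>p\<close> by all sufficiently small amounts preserves them, and only finitely many amounts
  send an entry into \<open>F\<close>.
\<close>

lemma drawing_generic:
  assumes "drawing \<tau> t\<^sub>0" and dist: "distinct \<tau>" and F: "finite F"
  shows "\<exists>t. drawing \<tau> t \<and> t p = 0 \<and> (\<forall>i<length \<tau>. i \<noteq> p \<longrightarrow> t i \<notin> F)"
proof -
  define n where "n = length \<tau>"
  define t where "t i = t\<^sub>0 i - t\<^sub>0 p" for i
  define y where "y i = height (LR_min \<tau> i) (t i)" for i
  have mono: "t i < t j" if "i < j" "j < n" for i j
    using assms(1) that by (auto simp: drawing_def t_def n_def strict_mono_on_def)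
  have y: "\<tau> ! i < \<tau> ! j \<longleftrightarrow> y i < y j" if "i < n" "j < n" for i j
    using assms(1) that by (auto simp: drawing_def t_def y_def n_def height_def)
  obtain d\<^sub>1 where d1: "d\<^sub>1 > 0" "\<forall>i\<in>{..<n}. \<forall>j\<in>{..<n}. t i < t j \<longrightarrow> t i + d\<^sub>1 \<le> t j"
    using finite_gap[of "{..<n}" t] by auto
  obtain d\<^sub>2 where d2: "d\<^sub>2 > 0" "\<forall>i\<in>{..<n}. \<forall>j\<in>{..<n}. y i < y j \<longrightarrow> y i + d\<^sub>2 \<le> y j"
    using finite_gap[of "{..<n}" y] by auto
  define B where "B = (\<lambda>(i, x). x - t i) ` ({..<n} \<times> F)"
  have "infinite ({0<..<min d\<^sub>1 d\<^sub>2} - B)"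
    using d1(1) d2(1) F by (intro Diff_infinite_finite) (auto simp: B_def infinite_Ioo)
  then obtain \<epsilon> where e: "0 < \<epsilon>" "\<epsilon> < d\<^sub>1" "\<epsilon> < d\<^sub>2" "\<epsilon> \<notin> B"
    by (metis (no_types, lifting) Diff_iff all_not_in_conv finite.emptyI greaterThanLessThan_iff
        min_less_iff_conj)
  define t' where "t' i = (if i = p then t i else t i + \<epsilon>)" for i
  have "t' i < t' j" if "i < j" "j < n" for i j
    using mono[OF that] d1(2)[rule_format, of i j] that e by (auto simp: t'_def)
  moreover have "\<tau> ! i < \<tau> ! j \<longleftrightarrow> height (LR_min \<tau> i) (t' i) < height (LR_min \<tau> j) (t' j)"
    if ij: "i < n" "j < n" for i j
  proof -
    define y' where "y' i = height (LR_min \<tau> i) (t' i)" for i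
    have y': "y' i = (if i = p then y i else y i - \<epsilon>)" for i
      by (auto simp: y'_def y_def t'_def height_def)
    have less: "y' i < y' j" if "y i < y j" "i < n" "j < n" for i j
      using d2(2)[rule_format, of i j] that e by (auto simp: y')
    have "i = j \<or> y i < y j \<or> y j < y i"
      using y ij dist by (metis linorder_less_linear n_def nth_eq_iff_index_eq)
    then show ?thesis
      using y[OF ij] less[of i j] less[of j i] ij unfolding y'_def[symmetric] by auto
  qed
  moreover have "t' i \<notin> F" if "i < n" "i \<noteq> p" for i
  proof
    assume "t' i \<in> F"
    then have "(t i + \<epsilon>) - t i \<in> B" unfolding B_def using that by (force simp: t'_def)
    then show False using e by simp
  qed
  ultimately have "drawing \<tau> t'" "\<forall>i<length \<tau>. i \<noteq> p \<longrightarrow> t' i \<notin> F"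
    by (auto simp: drawing_def strict_mono_on_def n_def)
  moreover have "t' p = 0" by (simp add: t'_def t_def)
  ultimately show ?thesis by blast
qed

section \<open>The permutation of a point set\<close>

definition rank :: "real set \<Rightarrow> real \<Rightarrow> nat" where
  "rank A a = card {b \<in> A. b < a}"

lemma rank_strict_mono: "finite A \<Longrightarrow> strict_mono_on A (rank A)"
  unfolding rank_def by (intro strict_mono_onI psubset_card_mono) auto

lemma rank_bij:
  assumes "finite A"
  shows "bij_betw (rank A) A {..<card A}"
proof -
  have inj: "inj_on (rank A) A" using rank_strict_mono[OF assms] by (rule strict_mono_on_imp_inj_on)
  have "rank A a < card A" if "a \<in> A" for a
    unfolding rank_def using that assms by (intro psubset_card_mono) auto
  then have "rank A ` A = {..<card A}"
    using inj by (intro card_subset_eq) (auto simp: card_image)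
  then show ?thesis using inj by (simp add: bij_betw_def)
qed

text \<open>The permutation lists, from left to right, the ranks of the heights of the points \<open>(x, h x)\<close>.\<close>

lemma standardization:
  fixes X :: "real set" and h :: "real \<Rightarrow> real"
  assumes X: "finite X" "X \<noteq> {}" and h: "inj_on h X"
  obtains \<sigma> pos where "is_perm \<sigma>" "bij_betw pos X {..<length \<sigma>}" "strict_mono_on X pos"
    "\<And>x z. \<lbrakk>x \<in> X; z \<in> X\<rbrakk> \<Longrightarrow> \<sigma> ! pos x < \<sigma> ! pos z \<longleftrightarrow> h x < h z"
proof -
  define pos where "pos = rank X"
  define val where "val x = Suc (rank (h ` X) (h x))" for x
  define \<sigma> where "\<sigma> = map (\<lambda>k. val (inv_into X pos k)) [0..<card X]"
  have len: "length \<sigma> = card X" by (simp add: \<sigma>_def)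
  have bij: "bij_betw pos X {..<card X}" unfolding pos_def using X(1) by (rule rank_bij)
  have mono: "strict_mono_on X pos" unfolding pos_def using X(1) by (rule rank_strict_mono)
  have nth: "\<sigma> ! pos x = val x" if "x \<in> X" for x
  proof -
    have "pos x < card X" using bij that by (auto simp: bij_betw_def)
    then show ?thesis
      using bij that by (simp add: \<sigma>_def bij_betw_def inv_into_f_f)
  qed
  have "set \<sigma> = val ` inv_into X pos ` {..<card X}" by (auto simp: \<sigma>_def)
  also have "inv_into X pos ` {..<card X} = X"
    using bij_betw_inv_into[OF bij] by (simp add: bij_betw_def)
  also have "val ` X = Suc ` rank (h ` X) ` (h ` X)" by (auto simp: val_def)
  also have "\<dots> = {1..card X}"
    using rank_bij[of "h ` X"] X(1) h
    by (simp add: bij_betw_def card_image image_Suc_lessThan)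
  finally have set: "set \<sigma> = {1..card X}" .
  then have "distinct \<sigma>" by (intro card_distinct) (simp add: len)
  then have "is_perm \<sigma>" using set X len by (auto simp: is_perm_def)
  moreover have "\<sigma> ! pos x < \<sigma> ! pos z \<longleftrightarrow> h x < h z" if "x \<in> X" "z \<in> X" for x z
    using that nth strict_mono_on_less[OF rank_strict_mono[of "h ` X"], of "h x" "h z"] X(1)
    by (simp add: val_def)
  ultimately show ?thesis using that bij mono len by simp
qed

text \<open>\<open>X\<close> is the set of first coordinates and \<open>M\<close> selects those of the points on the lower line.\<close>

lemma two_lines_perm:
  fixes X M :: "real set"
  defines "h \<equiv> \<lambda>x. height (x \<in> M) x"
  assumes X: "finite X" "X \<noteq> {}" and inj: "inj_on h X"
  obtains \<sigma> pos where "\<sigma> \<in> Av [1, 2, 3]" "strict_mono_on X pos" "pos ` X = {..<length \<sigma>}"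
    "\<And>x z. \<lbrakk>x \<in> X; z \<in> X\<rbrakk> \<Longrightarrow> \<sigma> ! pos x < \<sigma> ! pos z \<longleftrightarrow> h x < h z"
    "\<And>x. x \<in> X \<inter> M \<Longrightarrow> LR_min \<sigma> (pos x)"
proof -
  obtain \<sigma> pos where \<sigma>: "is_perm \<sigma>" and bij: "bij_betw pos X {..<length \<sigma>}"
    and mono: "strict_mono_on X pos"
    and val: "\<And>x z. \<lbrakk>x \<in> X; z \<in> X\<rbrakk> \<Longrightarrow> \<sigma> ! pos x < \<sigma> ! pos z \<longleftrightarrow> h x < h z"
    using standardization[OF X inj] by blast
  have im: "pos ` X = {..<length \<sigma>}" using bij by (simp add: bij_betw_def)
  have ex: "\<exists>x\<in>X. i = pos x" if "i < length \<sigma>" for i using im that by blast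
  have less: "x < z" if "pos x < pos z" "x \<in> X" "z \<in> X" for x z
    using strict_mono_on_less[OF mono] that by blast
  have "\<not> contains \<sigma> [1, 2, 3]"
  proof
    assume "contains \<sigma> [1, 2, 3]"
    then obtain i j k where ijk: "i < j" "j < k" "k < length \<sigma>" "\<sigma> ! i < \<sigma> ! j" "\<sigma> ! j < \<sigma> ! k"
      unfolding contains_123_iff by blast
    obtain a b c where abc: "a \<in> X" "b \<in> X" "c \<in> X" "i = pos a" "j = pos b" "k = pos c"
      using ex ijk by (meson order.strict_trans)
    have "a < b" "b < c" "h a < h b" "h b < h c" using abc ijk less val by auto
    then show False by (auto simp: h_def height_def split: if_splits)
  qed
  moreover have "LR_min \<sigma> (pos x)" if x: "x \<in> X \<inter> M" for x
    unfolding LR_min_def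
  proof (intro conjI allI impI)
    show "pos x < length \<sigma>" using im x by blast
    fix j assume j: "j < pos x"
    then obtain z where z: "z \<in> X" "j = pos z" using ex \<open>pos x < length \<sigma>\<close> by (meson order.strict_trans)
    then have "z < x" using less j x by blast
    then have "h x < h z" using x by (auto simp: h_def height_def)
    then show "\<sigma> ! pos x < \<sigma> ! j" using val x z by blast
  qed
  ultimately show ?thesis using that \<sigma> mono im val by (auto simp: Av_def)
qed

section \<open>Superimposing two drawings\<close>

lemma drawing_embedding:
  assumes d: "drawing \<tau> t" and sub: "t ` {..<length \<tau>} \<subseteq> X"
    and low: "\<And>i. i < length \<tau> \<Longrightarrow> t i \<in> M \<longleftrightarrow> LR_min \<tau> i"
    and mono: "strict_mono_on X pos" and im: "pos ` X = {..<length \<sigma>}"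
    and val: "\<And>x z. \<lbrakk>x \<in> X; z \<in> X\<rbrakk> \<Longrightarrow>
      \<sigma> ! pos x < \<sigma> ! pos z \<longleftrightarrow> height (x \<in> M) x < height (z \<in> M) z"
  shows "embedding (pos \<circ> t) \<tau> \<sigma>"
  unfolding embedding_def
proof (intro conjI allI impI)
  show "(pos \<circ> t) ` {..<length \<tau>} \<subseteq> {..<length \<sigma>}" using sub im by (auto simp: image_comp[symmetric])
  show "strict_mono_on {..<length \<tau>} (pos \<circ> t)"
    using d mono sub by (auto simp: drawing_def strict_mono_on_def image_subset_iff)
  fix i j assume ij: "i < length \<tau>" "j < length \<tau>"
  then have "t i \<in> X" "t j \<in> X" using sub by auto
  then show "\<tau> ! i < \<tau> ! j \<longleftrightarrow> \<sigma> ! (pos \<circ> t) i < \<sigma> ! (pos \<circ> t) j"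
    using d ij low val by (auto simp: drawing_def)
qed

lemma drawing_height_inj:
  assumes "drawing \<tau> t" "distinct \<tau>" "i < length \<tau>" "j < length \<tau>"
    and "height (LR_min \<tau> i) (t i) = height (LR_min \<tau> j) (t j)"
  shows "i = j"
  using assms unfolding drawing_def by (metis linorder_less_linear nth_eq_iff_index_eq order.irrefl)

lemma amalgamate_Av_123:
  assumes \<tau>: "\<tau>\<^sub>1 \<in> Av [1, 2, 3]" "\<tau>\<^sub>2 \<in> Av [1, 2, 3]"
    and p1: "p\<^sub>1 < length \<tau>\<^sub>1" "\<not> LR_min \<tau>\<^sub>1 p\<^sub>1"
    and p2: "p\<^sub>2 < length \<tau>\<^sub>2" "\<not> LR_min \<tau>\<^sub>2 p\<^sub>2"
  shows "\<exists>\<sigma>\<in>Av [1, 2, 3]. \<exists>g\<^sub>1 g\<^sub>2. embedding g\<^sub>1 \<tau>\<^sub>1 \<sigma> \<and> embedding g\<^sub>2 \<tau>\<^sub>2 \<sigma> \<and> g\<^sub>1 p\<^sub>1 = g\<^sub>2 p\<^sub>2 \<and>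
    preserves_LR_min g\<^sub>1 \<tau>\<^sub>1 \<sigma> \<and> preserves_LR_min g\<^sub>2 \<tau>\<^sub>2 \<sigma>"
proof -
  have dist: "distinct \<tau>\<^sub>1" "distinct \<tau>\<^sub>2"
    and av: "\<not> contains \<tau>\<^sub>1 [1, 2, 3]" "\<not> contains \<tau>\<^sub>2 [1, 2, 3]"
    using \<tau> by (auto simp: Av_def is_perm_def)
  obtain t\<^sub>1 where d1: "drawing \<tau>\<^sub>1 t\<^sub>1" and t1p: "t\<^sub>1 p\<^sub>1 = 0"
    using drawing_exists[OF dist(1) av(1)] drawing_generic[OF _ dist(1) finite.emptyI] by blast
  define X\<^sub>1 where "X\<^sub>1 = t\<^sub>1 ` {..<length \<tau>\<^sub>1}"
  \<comment> \<open>Heights on the two lines can agree only for points whose first coordinates differ by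
     at most the distance \<open>1\<close> of the lines.\<close>
  define F where "F = X\<^sub>1 \<union> (\<lambda>x. x + 1) ` X\<^sub>1 \<union> (\<lambda>x. x - 1) ` X\<^sub>1"
  have "finite F" by (simp add: F_def X\<^sub>1_def)
  then obtain t\<^sub>2 where d2: "drawing \<tau>\<^sub>2 t\<^sub>2" and t2p: "t\<^sub>2 p\<^sub>2 = 0"
    and t2F: "\<And>i. \<lbrakk>i < length \<tau>\<^sub>2; i \<noteq> p\<^sub>2\<rbrakk> \<Longrightarrow> t\<^sub>2 i \<notin> F"
    using drawing_exists[OF dist(2) av(2)] drawing_generic[OF _ dist(2)] by blast
  define X\<^sub>2 where "X\<^sub>2 = t\<^sub>2 ` {..<length \<tau>\<^sub>2}"
  define M where "M = t\<^sub>1 ` {i. LR_min \<tau>\<^sub>1 i} \<union> t\<^sub>2 ` {i. LR_min \<tau>\<^sub>2 i}"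
  define h where "h = (\<lambda>x. height (x \<in> M) x)"
  have inj1: "i = j" if "t\<^sub>1 i = t\<^sub>1 j" "i < length \<tau>\<^sub>1" "j < length \<tau>\<^sub>1" for i j
    using d1 that strict_mono_on_imp_inj_on[of "{..<length \<tau>\<^sub>1}" t\<^sub>1]
    by (auto simp: drawing_def dest: inj_onD)
  have inj2: "i = j" if "t\<^sub>2 i = t\<^sub>2 j" "i < length \<tau>\<^sub>2" "j < length \<tau>\<^sub>2" for i j
    using d2 that strict_mono_on_imp_inj_on[of "{..<length \<tau>\<^sub>2}" t\<^sub>2]
    by (auto simp: drawing_def dest: inj_onD)
  have common: "i = p\<^sub>1 \<and> j = p\<^sub>2" if "t\<^sub>1 i = t\<^sub>2 j" "i < length \<tau>\<^sub>1" "j < length \<tau>\<^sub>2" for i j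
  proof -
    have "t\<^sub>2 j \<in> F" using that(1)[symmetric] that(2) by (auto simp: F_def X\<^sub>1_def)
    then have "j = p\<^sub>2" using t2F that by blast
    then show ?thesis using inj1[of i p\<^sub>1] that t1p t2p p1 by auto
  qed
  \<comment> \<open>The only common point is marked in both drawings, and there it lies on the upper line.\<close>
  have low1: "t\<^sub>1 i \<in> M \<longleftrightarrow> LR_min \<tau>\<^sub>1 i" if "i < length \<tau>\<^sub>1" for i
    using inj1 common p2 that unfolding M_def LR_min_def by blast
  have low2: "t\<^sub>2 i \<in> M \<longleftrightarrow> LR_min \<tau>\<^sub>2 i" if "i < length \<tau>\<^sub>2" for i
    using inj2 common[OF sym] p1 that unfolding M_def LR_min_def by blast
  have h1: "inj_on h X\<^sub>1"
    using drawing_height_inj[OF d1 dist(1)] low1 by (auto simp: inj_on_def h_def X\<^sub>1_def)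
  have h2: "inj_on h X\<^sub>2"
    using drawing_height_inj[OF d2 dist(2)] low2 by (auto simp: inj_on_def h_def X\<^sub>2_def)
  have cross: "x = z" if xz: "x \<in> X\<^sub>1" "z \<in> X\<^sub>2" "h x = h z" for x z
  proof (cases "z \<in> X\<^sub>1")
    case True
    then show ?thesis using h1 xz by (auto dest: inj_onD)
  next
    case False
    obtain j where j: "j < length \<tau>\<^sub>2" "z = t\<^sub>2 j" using xz by (auto simp: X\<^sub>2_def)
    have "0 \<in> X\<^sub>1" using t1p p1 by (force simp: X\<^sub>1_def)
    then have "j \<noteq> p\<^sub>2" using False j t2p by auto
    have "z = x \<or> z = x + 1 \<or> z = x - 1"
      using xz(3) by (auto simp: h_def height_def split: if_splits)
    then have "z \<in> F" using xz(1) by (auto simp: F_def)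
    then show ?thesis using t2F j \<open>j \<noteq> p\<^sub>2\<close> by blast
  qed
  have inj: "inj_on h (X\<^sub>1 \<union> X\<^sub>2)"
    using h1 h2 cross unfolding inj_on_def by (metis Un_iff)
  have fin: "finite (X\<^sub>1 \<union> X\<^sub>2)" "X\<^sub>1 \<union> X\<^sub>2 \<noteq> {}" using p1 by (auto simp: X\<^sub>1_def X\<^sub>2_def)
  obtain \<sigma> pos where \<sigma>: "\<sigma> \<in> Av [1, 2, 3]" and mono: "strict_mono_on (X\<^sub>1 \<union> X\<^sub>2) pos"
    and im: "pos ` (X\<^sub>1 \<union> X\<^sub>2) = {..<length \<sigma>}"
    and val: "\<And>x z. \<lbrakk>x \<in> X\<^sub>1 \<union> X\<^sub>2; z \<in> X\<^sub>1 \<union> X\<^sub>2\<rbrakk> \<Longrightarrow>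
      \<sigma> ! pos x < \<sigma> ! pos z \<longleftrightarrow> height (x \<in> M) x < height (z \<in> M) z"
    and LR: "\<And>x. x \<in> (X\<^sub>1 \<union> X\<^sub>2) \<inter> M \<Longrightarrow> LR_min \<sigma> (pos x)"
    using two_lines_perm[OF fin inj[unfolded h_def]] by blast
  have "embedding (pos \<circ> t\<^sub>1) \<tau>\<^sub>1 \<sigma>"
    by (rule drawing_embedding[OF d1 _ low1 mono im val]) (auto simp: X\<^sub>1_def)
  moreover have "embedding (pos \<circ> t\<^sub>2) \<tau>\<^sub>2 \<sigma>"
    by (rule drawing_embedding[OF d2 _ low2 mono im val]) (auto simp: X\<^sub>2_def)
  moreover have "t\<^sub>1 i \<in> (X\<^sub>1 \<union> X\<^sub>2) \<inter> M" if "LR_min \<tau>\<^sub>1 i" for i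
    using that by (auto simp: X\<^sub>1_def M_def LR_min_def)
  then have "preserves_LR_min (pos \<circ> t\<^sub>1) \<tau>\<^sub>1 \<sigma>" using LR by (simp add: preserves_LR_min_def)
  moreover have "t\<^sub>2 i \<in> (X\<^sub>1 \<union> X\<^sub>2) \<inter> M" if "LR_min \<tau>\<^sub>2 i" for i
    using that by (auto simp: X\<^sub>2_def M_def LR_min_def)
  then have "preserves_LR_min (pos \<circ> t\<^sub>2) \<tau>\<^sub>2 \<sigma>" using LR by (simp add: preserves_LR_min_def)
  moreover have "(pos \<circ> t\<^sub>1) p\<^sub>1 = (pos \<circ> t\<^sub>2) p\<^sub>2" using t1p t2p by simp
  ultimately show ?thesis using \<sigma> by blast
qed

theorem lemma5p5: "LR_amalgamable (Av [1, 2, 3])"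
  unfolding LR_amalgamable_def
proof (intro conjI ballI allI impI)
  show "perm_class (Av [1, 2, 3])" by (rule perm_class_Av)
next
  fix \<tau>\<^sub>1 \<tau>\<^sub>2 f\<^sub>1 f\<^sub>2
  assume \<tau>: "\<tau>\<^sub>1 \<in> Av [1, 2, 3]" "\<tau>\<^sub>2 \<in> Av [1, 2, 3]"
    and f: "embedding f\<^sub>1 [1] \<tau>\<^sub>1 \<and> \<not> LR_min \<tau>\<^sub>1 (f\<^sub>1 0) \<and> embedding f\<^sub>2 [1] \<tau>\<^sub>2 \<and> \<not> LR_min \<tau>\<^sub>2 (f\<^sub>2 0)"
  then have "f\<^sub>1 0 < length \<tau>\<^sub>1" "f\<^sub>2 0 < length \<tau>\<^sub>2" by (auto simp: embedding_def)
  then show "\<exists>\<sigma>\<in>Av [1, 2, 3]. \<exists>g\<^sub>1 g\<^sub>2. embedding g\<^sub>1 \<tau>\<^sub>1 \<sigma> \<and> embedding g\<^sub>2 \<tau>\<^sub>2 \<sigma> \<and>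
      (g\<^sub>1 \<circ> f\<^sub>1) 0 = (g\<^sub>2 \<circ> f\<^sub>2) 0 \<and> preserves_LR_min g\<^sub>1 \<tau>\<^sub>1 \<sigma> \<and> preserves_LR_min g\<^sub>2 \<tau>\<^sub>2 \<sigma>"
    using amalgamate_Av_123[OF \<tau>, of "f\<^sub>1 0" "f\<^sub>2 0"] f by simp
qed

end
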